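(* Let $(A,[-,-],[-,-,-])$ be an Akivis algebra and let $\alpha,\beta$ be commuting endomorphisms of $(A,[-,-],[-,-,-])$. Define on $A$, for all $x,y,z\in A$, $$[x,y]_{\alpha,\beta}:=[\alpha(x),\beta(y)],\qquad [x,y,z]_{\alpha,\beta}:=\alpha\beta^2([x,y,z]).$$ Then $A_{\alpha,\beta}=(A,[-,-]_{\alpha,\beta},[-,-,-]_{\alpha,\beta},\alpha,\beta)$ is a multiplicative BiHom-Akivis algebra. Moreover, suppose that $(B,\{-,-\},\{-,-,-\})$ is another Akivis algebra and that $\varphi,\psi$ are commuting endomorphisms of $B$; put $\{x,y\}_{\varphi,\psi}:=\{\varphi(x),\psi(y)\}$ and $\{x,y,z\}_{\varphi,\psi}:=\varphi\psi^2(\{x,y,z\})$. If $f:A\to B$ is an Akivis algebra morphism satisfying $f\circ\alpha=\varphi\circ f$ and $f\circ\beta=\psi\circ f$, then $$f:(A,[-,-]_{\alpha,\beta},[-,-,-]_{\alpha,\beta},\alpha,\beta)\to(B,\{-,-\}_{\varphi,\psi},\{-,-,-\}_{\varphi,\psi},\varphi,\psi)$$ is a morphism of multiplicative BiHom-Akivis algebras.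
   Context: All vector spaces are over a field $\mathbb{K}$ of characteristic $0$. Below, $\sum_{\mathrm{cyc}}$ denotes the sum over the three cyclic permutations of $(x,y,z)$. An Akivis algebra $(A,[-,-],[-,-,-])$ is a vector space with a bilinear skew-symmetric map $[-,-]$ and a trilinear map $[-,-,-]$ such that $\sum_{\mathrm{cyc}}[x,[y,z]]=\sum_{\mathrm{cyc}}[x,y,z]-\sum_{\mathrm{cyc}}[y,x,z]$ for all $x,y,z\in A$. Morphisms (endomorphisms) of Akivis algebras are linear maps preserving both the binary and the ternary operations. A BiHom-Akivis algebra is a quintuple $(V,[-,-],[-,-,-],\alpha,\beta)$ where $V$ is a vector space, $\alpha,\beta:V\to V$ are commuting linear maps, $[-,-]:V\times V\to V$ is bilinear and BiHom-skew-symmetric, i.e. $[\beta(x),\alpha(y)]=-[\beta(y),\alpha(x)]$ for all $x,y$, and $[-,-,-]:V^{3}\to V$ is trilinear, such that for all $x,y,z\in V$ $$\sum_{\mathrm{cyc}}[\beta^2(x),[\beta(y),\alpha(z)]]=\sum_{\mathrm{cyc}}[x,y,z]-\sum_{\mathrm{cyc}}[y,x,z].$$ It is multiplicative if $\alpha$ and $\beta$ are endomorphisms with respect to both $[-,-]$ and $[-,-,-]$. A morphism of BiHom-Akivis algebras is a linear map preserving the binary and ternary operations and intertwining the respective twisting maps ($f\circ\alpha=\tilde\alpha\circ f$, $f\circ\beta=\tilde\beta\circ f$). *)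

theory Defs
  imports Complex_Main
begin

definition cyclic_sum :: "('a \<Rightarrow> 'a \<Rightarrow> 'a \<Rightarrow> 'b::ab_group_add) \<Rightarrow> 'a \<Rightarrow> 'a \<Rightarrow> 'a \<Rightarrow> 'b" where
  "cyclic_sum F x y z = F x y z + F y z x + F z x y"

text \<open>The underlying vector space is the whole type \<open>'a\<close>, with scalar multiplication \<open>scale\<close>.\<close>

locale bracket_space = vector_space scale
  for scale :: "'k::field_char_0 \<Rightarrow> 'a::ab_group_add \<Rightarrow> 'a" +
  fixes br :: "'a \<Rightarrow> 'a \<Rightarrow> 'a"
    and tr :: "'a \<Rightarrow> 'a \<Rightarrow> 'a \<Rightarrow> 'a"
  assumes br_linear_1: "\<And>y. Vector_Spaces.linear scale scale (\<lambda>x. br x y)"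
    and br_linear_2: "\<And>x. Vector_Spaces.linear scale scale (\<lambda>y. br x y)"
    and tr_linear_1: "\<And>y z. Vector_Spaces.linear scale scale (\<lambda>x. tr x y z)"
    and tr_linear_2: "\<And>x z. Vector_Spaces.linear scale scale (\<lambda>y. tr x y z)"
    and tr_linear_3: "\<And>x y. Vector_Spaces.linear scale scale (\<lambda>z. tr x y z)"

locale akivis_algebra = bracket_space scale br tr
  for scale :: "'k::field_char_0 \<Rightarrow> 'a::ab_group_add \<Rightarrow> 'a" and br tr +
  assumes skew: "\<And>x y. br x y = - br y x"
    and akivis_identity: "\<And>x y z.
      cyclic_sum (\<lambda>x y z. br x (br y z)) x y z =
      cyclic_sum (\<lambda>x y z. tr x y z) x y z - cyclic_sum (\<lambda>x y z. tr y x z) x y z"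

locale akivis_morphism =
  A: akivis_algebra sA brA trA + B: akivis_algebra sB brB trB + Vector_Spaces.linear sA sB f
  for sA :: "'k::field_char_0 \<Rightarrow> 'a::ab_group_add \<Rightarrow> 'a" and brA trA
    and sB :: "'k \<Rightarrow> 'b::ab_group_add \<Rightarrow> 'b" and brB trB
    and f :: "'a \<Rightarrow> 'b" +
  assumes preserves_br: "\<And>x y. f (brA x y) = brB (f x) (f y)"
    and preserves_tr: "\<And>x y z. f (trA x y z) = trB (f x) (f y) (f z)"

abbreviation akivis_endomorphism ::
  "('k::field_char_0 \<Rightarrow> 'a::ab_group_add \<Rightarrow> 'a) \<Rightarrow> ('a \<Rightarrow> 'a \<Rightarrow> 'a) \<Rightarrow> ('a \<Rightarrow> 'a \<Rightarrow> 'a \<Rightarrow> 'a)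
    \<Rightarrow> ('a \<Rightarrow> 'a) \<Rightarrow> bool" where
  "akivis_endomorphism scale br tr f \<equiv> akivis_morphism scale br tr scale br tr f"

locale bihom_akivis_algebra = bracket_space scale br tr
  for scale :: "'k::field_char_0 \<Rightarrow> 'a::ab_group_add \<Rightarrow> 'a" and br tr +
  fixes \<alpha> \<beta> :: "'a \<Rightarrow> 'a"
  assumes alpha_linear: "Vector_Spaces.linear scale scale \<alpha>"
    and beta_linear: "Vector_Spaces.linear scale scale \<beta>"
    and twists_commute: "\<alpha> \<circ> \<beta> = \<beta> \<circ> \<alpha>"
    and bihom_skew: "\<And>x y. br (\<beta> x) (\<alpha> y) = - br (\<beta> y) (\<alpha> x)"
    and bihom_akivis_identity: "\<And>x y z.
      cyclic_sum (\<lambda>x y z. br (\<beta> (\<beta> x)) (br (\<beta> y) (\<alpha> z))) x y z =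
      cyclic_sum (\<lambda>x y z. tr x y z) x y z - cyclic_sum (\<lambda>x y z. tr y x z) x y z"

locale multiplicative_bihom_akivis_algebra = bihom_akivis_algebra scale br tr \<alpha> \<beta>
  for scale :: "'k::field_char_0 \<Rightarrow> 'a::ab_group_add \<Rightarrow> 'a" and br tr \<alpha> \<beta> +
  assumes alpha_br: "\<And>x y. \<alpha> (br x y) = br (\<alpha> x) (\<alpha> y)"
    and alpha_tr: "\<And>x y z. \<alpha> (tr x y z) = tr (\<alpha> x) (\<alpha> y) (\<alpha> z)"
    and beta_br: "\<And>x y. \<beta> (br x y) = br (\<beta> x) (\<beta> y)"
    and beta_tr: "\<And>x y z. \<beta> (tr x y z) = tr (\<beta> x) (\<beta> y) (\<beta> z)"

locale bihom_akivis_morphism =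
  A: bihom_akivis_algebra sA brA trA \<alpha> \<beta> + B: bihom_akivis_algebra sB brB trB \<phi> \<psi> +
  Vector_Spaces.linear sA sB f
  for sA :: "'k::field_char_0 \<Rightarrow> 'a::ab_group_add \<Rightarrow> 'a" and brA trA \<alpha> \<beta>
    and sB :: "'k \<Rightarrow> 'b::ab_group_add \<Rightarrow> 'b" and brB trB \<phi> \<psi>
    and f :: "'a \<Rightarrow> 'b" +
  assumes preserves_br: "\<And>x y. f (brA x y) = brB (f x) (f y)"
    and preserves_tr: "\<And>x y z. f (trA x y z) = trB (f x) (f y) (f z)"
    and intertwines_1: "f \<circ> \<alpha> = \<phi> \<circ> f"
    and intertwines_2: "f \<circ> \<beta> = \<psi> \<circ> f"

locale multiplicative_bihom_akivis_morphism =
  bihom_akivis_morphism sA brA trA \<alpha> \<beta> sB brB trB \<phi> \<psi> f +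
  A: multiplicative_bihom_akivis_algebra sA brA trA \<alpha> \<beta> +
  B: multiplicative_bihom_akivis_algebra sB brB trB \<phi> \<psi>
  for sA :: "'k::field_char_0 \<Rightarrow> 'a::ab_group_add \<Rightarrow> 'a" and brA trA \<alpha> \<beta>
    and sB :: "'k \<Rightarrow> 'b::ab_group_add \<Rightarrow> 'b" and brB trB \<phi> \<psi>
    and f :: "'a \<Rightarrow> 'b"

definition twisted_br ::
  "('a \<Rightarrow> 'a \<Rightarrow> 'a) \<Rightarrow> ('a \<Rightarrow> 'a) \<Rightarrow> ('a \<Rightarrow> 'a) \<Rightarrow> 'a \<Rightarrow> 'a \<Rightarrow> 'a" where
  "twisted_br br \<alpha> \<beta> x y = br (\<alpha> x) (\<beta> y)"

definition twisted_tr ::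
  "('a \<Rightarrow> 'a \<Rightarrow> 'a \<Rightarrow> 'a) \<Rightarrow> ('a \<Rightarrow> 'a) \<Rightarrow> ('a \<Rightarrow> 'a) \<Rightarrow> 'a \<Rightarrow> 'a \<Rightarrow> 'a \<Rightarrow> 'a" where
  "twisted_tr tr \<alpha> \<beta> x y z = \<alpha> (\<beta> (\<beta> (tr x y z)))"

end

theory Submission
  imports Defs
begin

text \<open>
  Put \<open>\<kappa> = \<alpha> \<circ> \<beta> \<circ> \<beta>\<close>, which is again an endomorphism. In the nested
  bracket of the BiHom-Akivis identity, the twists written in the identity and the twists hidden in
  the new bracket combine so that each of the three arguments receives \<open>\<kappa>\<close> exactly once:
  \<open>[\<beta>\<^sup>2 x, [\<beta> y, \<alpha> z]\<^sub>\<alpha>\<^sub>,\<^sub>\<beta>]\<^sub>\<alpha>\<^sub>,\<^sub>\<beta> = [\<kappa> x, [\<kappa> y, \<kappa> z]] = \<kappa> [x, [y, z]]\<close>.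
  Since the new ternary operation is \<open>\<kappa>\<close> applied to the old one, the
  BiHom-Akivis identity is the image of the Akivis identity under the linear map \<open>\<kappa>\<close>.
  BiHom-skew-symmetry is skew-symmetry at \<open>\<alpha> (\<beta> x)\<close> and \<open>\<alpha> (\<beta> y)\<close>, and multiplicativity
  and the statement on morphisms follow by moving linear maps past the operations and past
  each other.
\<close>

locale akivis_twist =
  akivis_algebra scale br tr +
  a: akivis_morphism scale br tr scale br tr \<alpha> +
  b: akivis_morphism scale br tr scale br tr \<beta>
  for scale :: "'k::field_char_0 \<Rightarrow> 'a::ab_group_add \<Rightarrow> 'a" and br tr \<alpha> \<beta> +
  assumes commute: "\<alpha> \<circ> \<beta> = \<beta> \<circ> \<alpha>"
begin

text \<open>
  As a rewrite rule this moves every \<open>\<alpha>\<close> inside every \<open>\<beta>\<close>, so that words in the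
  two maps have a normal form and the twisted identities can be compared by simplification.
\<close>

lemma commute_apply: "\<alpha> (\<beta> x) = \<beta> (\<alpha> x)"
  using commute by (metis comp_apply)

lemma linear_ternary_twist: "Vector_Spaces.linear scale scale (\<lambda>x. \<alpha> (\<beta> (\<beta> x)))"
  using Vector_Spaces.linear_compose[OF Vector_Spaces.linear_compose[OF b.linear_axioms b.linear_axioms] a.linear_axioms]
  by (simp add: comp_def)

lemma twisted_bracket_space:
  "bracket_space scale (twisted_br br \<alpha> \<beta>) (twisted_tr tr \<alpha> \<beta>)"
proof (intro bracket_space.intro bracket_space_axioms.intro vector_space_axioms)
  show "Vector_Spaces.linear scale scale (\<lambda>x. twisted_br br \<alpha> \<beta> x y)" for y
    using Vector_Spaces.linear_compose[OF a.linear_axioms br_linear_1]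
    by (simp add: comp_def twisted_br_def)
  show "Vector_Spaces.linear scale scale (\<lambda>y. twisted_br br \<alpha> \<beta> x y)" for x
    using Vector_Spaces.linear_compose[OF b.linear_axioms br_linear_2]
    by (simp add: comp_def twisted_br_def)
  show "Vector_Spaces.linear scale scale (\<lambda>x. twisted_tr tr \<alpha> \<beta> x y z)" for y z
    using Vector_Spaces.linear_compose[OF tr_linear_1 linear_ternary_twist]
    by (simp add: comp_def twisted_tr_def)
  show "Vector_Spaces.linear scale scale (\<lambda>y. twisted_tr tr \<alpha> \<beta> x y z)" for x z
    using Vector_Spaces.linear_compose[OF tr_linear_2 linear_ternary_twist]
    by (simp add: comp_def twisted_tr_def)
  show "Vector_Spaces.linear scale scale (\<lambda>z. twisted_tr tr \<alpha> \<beta> x y z)" for x y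
    using Vector_Spaces.linear_compose[OF tr_linear_3 linear_ternary_twist]
    by (simp add: comp_def twisted_tr_def)
qed

text \<open>
  The inner bracket contributes one \<open>\<alpha>\<close> on the left and one \<open>\<beta>\<close> on the right, the outer
  bracket does the same for its two arguments, and multiplicativity of \<open>\<beta>\<close> distributes the
  outer one over the inner bracket; counting gives one \<open>\<alpha>\<close> and two \<open>\<beta>\<close> on each
  of \<open>x\<close>, \<open>y\<close> and \<open>z\<close>.
\<close>

lemma twisted_nested_bracket:
  "twisted_br br \<alpha> \<beta> (\<beta> (\<beta> x)) (twisted_br br \<alpha> \<beta> (\<beta> y) (\<alpha> z)) =
    \<alpha> (\<beta> (\<beta> (br x (br y z))))"
  by (simp add: twisted_br_def a.preserves_br b.preserves_br commute_apply)

lemma twisted_bihom_identity: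
  "cyclic_sum (\<lambda>x y z. twisted_br br \<alpha> \<beta> (\<beta> (\<beta> x)) (twisted_br br \<alpha> \<beta> (\<beta> y) (\<alpha> z))) x y z =
    cyclic_sum (\<lambda>x y z. twisted_tr tr \<alpha> \<beta> x y z) x y z -
    cyclic_sum (\<lambda>x y z. twisted_tr tr \<alpha> \<beta> y x z) x y z"
proof -
  interpret k: Vector_Spaces.linear scale scale "\<lambda>x. \<alpha> (\<beta> (\<beta> x))"
    by (rule linear_ternary_twist)
  have "\<alpha> (\<beta> (\<beta> (cyclic_sum (\<lambda>x y z. br x (br y z)) x y z))) =
      \<alpha> (\<beta> (\<beta> (cyclic_sum (\<lambda>x y z. tr x y z) x y z - cyclic_sum (\<lambda>x y z. tr y x z) x y z)))"
    by (simp only: akivis_identity)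
  then show ?thesis
    unfolding twisted_nested_bracket twisted_tr_def cyclic_sum_def by (simp only: k.add k.diff)
qed

theorem twisted_multiplicative_bihom_akivis:
  "multiplicative_bihom_akivis_algebra scale (twisted_br br \<alpha> \<beta>) (twisted_tr tr \<alpha> \<beta>) \<alpha> \<beta>"
proof (intro multiplicative_bihom_akivis_algebra.intro bihom_akivis_algebra.intro
    multiplicative_bihom_akivis_algebra_axioms.intro bihom_akivis_algebra_axioms.intro
    twisted_bracket_space a.linear_axioms b.linear_axioms)
  show "\<alpha> \<circ> \<beta> = \<beta> \<circ> \<alpha>"
    by (rule commute)
  show "twisted_br br \<alpha> \<beta> (\<beta> x) (\<alpha> y) = - twisted_br br \<alpha> \<beta> (\<beta> y) (\<alpha> x)" for x y
    unfolding twisted_br_def commute_apply by (rule skew)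
  show "cyclic_sum (\<lambda>x y z. twisted_br br \<alpha> \<beta> (\<beta> (\<beta> x)) (twisted_br br \<alpha> \<beta> (\<beta> y) (\<alpha> z))) x y z =
      cyclic_sum (\<lambda>x y z. twisted_tr tr \<alpha> \<beta> x y z) x y z -
      cyclic_sum (\<lambda>x y z. twisted_tr tr \<alpha> \<beta> y x z) x y z" for x y z
    by (rule twisted_bihom_identity)
qed (simp_all add: twisted_br_def twisted_tr_def a.preserves_br a.preserves_tr
    b.preserves_br b.preserves_tr commute_apply)

end

lemma twisted_morphism:
  assumes A: "akivis_twist sA brA trA \<alpha> \<beta>"
    and B: "akivis_twist sB brB trB \<phi> \<psi>"
    and f: "akivis_morphism sA brA trA sB brB trB f"
    and f1: "f \<circ> \<alpha> = \<phi> \<circ> f" and f2: "f \<circ> \<beta> = \<psi> \<circ> f"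
  shows "multiplicative_bihom_akivis_morphism
      sA (twisted_br brA \<alpha> \<beta>) (twisted_tr trA \<alpha> \<beta>) \<alpha> \<beta>
      sB (twisted_br brB \<phi> \<psi>) (twisted_tr trB \<phi> \<psi>) \<phi> \<psi> f"
proof -
  interpret f: akivis_morphism sA brA trA sB brB trB f by (rule f)
  interpret TA: multiplicative_bihom_akivis_algebra sA "twisted_br brA \<alpha> \<beta>" "twisted_tr trA \<alpha> \<beta>" \<alpha> \<beta>
    by (rule akivis_twist.twisted_multiplicative_bihom_akivis[OF A])
  interpret TB: multiplicative_bihom_akivis_algebra sB "twisted_br brB \<phi> \<psi>" "twisted_tr trB \<phi> \<psi>" \<phi> \<psi>
    by (rule akivis_twist.twisted_multiplicative_bihom_akivis[OF B])
  have f_twists: "f (\<alpha> x) = \<phi> (f x)" "f (\<beta> x) = \<psi> (f x)" for x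
    using f1 f2 by (metis comp_apply)+
  show ?thesis
    by unfold_locales
      (simp_all add: f1 f2 twisted_br_def twisted_tr_def f.preserves_br f.preserves_tr f_twists)
qed

theorem corollary3p5:
  fixes sA :: "'k::field_char_0 \<Rightarrow> 'a::ab_group_add \<Rightarrow> 'a"
    and brA :: "'a \<Rightarrow> 'a \<Rightarrow> 'a" and trA :: "'a \<Rightarrow> 'a \<Rightarrow> 'a \<Rightarrow> 'a"
    and \<alpha> \<beta> :: "'a \<Rightarrow> 'a"
  assumes "akivis_algebra sA brA trA"
    and "akivis_endomorphism sA brA trA \<alpha>"
    and "akivis_endomorphism sA brA trA \<beta>"
    and "\<alpha> \<circ> \<beta> = \<beta> \<circ> \<alpha>"
  shows "multiplicative_bihom_akivis_algebra sA (twisted_br brA \<alpha> \<beta>) (twisted_tr trA \<alpha> \<beta>) \<alpha> \<beta> \<and>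
    (\<forall>(sB :: 'k \<Rightarrow> 'b::ab_group_add \<Rightarrow> 'b) brB trB \<phi> \<psi> f.
      akivis_algebra sB brB trB \<longrightarrow>
      akivis_endomorphism sB brB trB \<phi> \<longrightarrow>
      akivis_endomorphism sB brB trB \<psi> \<longrightarrow>
      \<phi> \<circ> \<psi> = \<psi> \<circ> \<phi> \<longrightarrow>
      akivis_morphism sA brA trA sB brB trB f \<longrightarrow>
      f \<circ> \<alpha> = \<phi> \<circ> f \<longrightarrow>
      f \<circ> \<beta> = \<psi> \<circ> f \<longrightarrow>
      multiplicative_bihom_akivis_morphism
        sA (twisted_br brA \<alpha> \<beta>) (twisted_tr trA \<alpha> \<beta>) \<alpha> \<beta>
        sB (twisted_br brB \<phi> \<psi>) (twisted_tr trB \<phi> \<psi>) \<phi> \<psi> f)"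
proof (intro conjI allI impI)
  have A: "akivis_twist sA brA trA \<alpha> \<beta>"
    using assms by (simp add: akivis_twist_def akivis_twist_axioms_def)
  show "multiplicative_bihom_akivis_algebra sA (twisted_br brA \<alpha> \<beta>) (twisted_tr trA \<alpha> \<beta>) \<alpha> \<beta>"
    by (rule akivis_twist.twisted_multiplicative_bihom_akivis[OF A])
  fix sB :: "'k \<Rightarrow> 'b \<Rightarrow> 'b" and brB trB \<phi> \<psi> f
  assume "akivis_algebra sB brB trB" "akivis_endomorphism sB brB trB \<phi>"
    "akivis_endomorphism sB brB trB \<psi>" "\<phi> \<circ> \<psi> = \<psi> \<circ> \<phi>"
  then have B: "akivis_twist sB brB trB \<phi> \<psi>"
    by (simp add: akivis_twist_def akivis_twist_axioms_def)
  assume "akivis_morphism sA brA trA sB brB trB f" "f \<circ> \<alpha> = \<phi> \<circ> f" "f \<circ> \<beta> = \<psi> \<circ> f"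
  then show "multiplicative_bihom_akivis_morphism
      sA (twisted_br brA \<alpha> \<beta>) (twisted_tr trA \<alpha> \<beta>) \<alpha> \<beta>
      sB (twisted_br brB \<phi> \<psi>) (twisted_tr trB \<phi> \<psi>) \<phi> \<psi> f"
    by (rule twisted_morphism[OF A B])
qed

end
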